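(* Let $(X,X_+)$ be a Dedekind complete pre-Riesz space. Then the intersection of arbitrarily many projection bands in $X$ is again a projection band. More precisely, if $\mathcal{P}$ is a set of band projections on $X$, then there exists a unique band projection $P_0$ on $X$ with range $\bigcap_{P \in \mathcal{P}} PX$; and if $\mathcal{P}$ is non-empty, then for each $x \in X_+$ the infimum below exists in $X$ and $$P_0 x = \inf\{Px : P \in \mathcal{P}\}.$$
   Context: An ordered vector space $(X,X_+)$ is a real vector space $X$ with a non-empty set $X_+ \subseteq X$ such that $X_+ \cap (-X_+) = \{0\}$ and $\alpha X_+ + \beta X_+ \subseteq X_+$ for all $\alpha,\beta \in [0,\infty)$; one writes $x \le y$ if $y - x \in X_+$. It is a pre-Riesz space if for every non-empty finite set $A \subseteq X$ and every $x \in X$: if every upper bound of $x + A$ is an upper bound of $A$, then $x \in X_+$. A pre-Riesz space $X$ is called Dedekind complete if $\sup A$ exists in $X$ for every non-empty upwards directed set $A \subseteq X$ that is bounded above. Two elements $x,y \in X$ are disjoint, $x \perp y$, if the sets $\{x+y,-x-y\}$ and $\{x-y,y-x\}$ have the same set of upper bounds in $X$. For $S \subseteq X$, $S^\perp := \{x \in X : x \perp s \text{ for all } s \in S\}$ (in a pre-Riesz space this is always a vector subspace). A set $B \subseteq X$ is a band if $B = B^{\perp\perp} := (B^\perp)^\perp$. A band $B$ is a projection band if $X = B \oplus B^\perp$. A linear projection $P: X \to X$ is a band projection if there is a projection band $B$ such that $P$ is the projection onto $B$ along $B^\perp$. The intersection over the empty index set is understood to be $X$. *)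

theory Defs
  imports Complex_Main "HOL-Library.Lub_Glb"
begin

text \<open>
  An ordered vector space \<open>(X, X\<^sub>+)\<close> is a type of class \<^class>\<open>ordered_real_vector\<close>, with positive
  cone \<open>X\<^sub>+ = {x. 0 \<le> x}\<close>; there \<open>x \<le> y\<close> is equivalent to \<open>y - x \<in> X\<^sub>+\<close>. Antisymmetry of the order
  amounts to \<open>X\<^sub>+ \<inter> -X\<^sub>+ = {0}\<close>.
\<close>

definition (in ord) upwards_directed :: "'a set \<Rightarrow> bool" where
  "upwards_directed A \<longleftrightarrow> (\<forall>x\<in>A. \<forall>y\<in>A. \<exists>z\<in>A. x \<le> z \<and> y \<le> z)"

class pre_riesz = ordered_real_vector +
  assumes pre_riesz:
    "A \<noteq> {} \<Longrightarrow> finite A \<Longrightarrow>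
      (\<And>u. \<forall>b\<in>(+) x ` A. b \<le> u \<Longrightarrow> \<forall>a\<in>A. a \<le> u) \<Longrightarrow> 0 \<le> x"

class dedekind_complete_pre_riesz = pre_riesz +
  assumes directed_sup_exists:
    "A \<noteq> {} \<Longrightarrow> upwards_directed A \<Longrightarrow> bdd_above A \<Longrightarrow>
      \<exists>s. (\<forall>a\<in>A. a \<le> s) \<and> (\<forall>u. (\<forall>a\<in>A. a \<le> u) \<longrightarrow> s \<le> u)"

definition disjoint_elems :: "'a::pre_riesz \<Rightarrow> 'a \<Rightarrow> bool" where
  "disjoint_elems x y \<longleftrightarrow> ubs UNIV {x + y, - x - y} = ubs UNIV {x - y, y - x}"

definition disjoint_compl :: "'a::pre_riesz set \<Rightarrow> 'a set" where
  "disjoint_compl S = {x. \<forall>s\<in>S. disjoint_elems x s}"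

definition band :: "'a::pre_riesz set \<Rightarrow> bool" where
  "band B \<longleftrightarrow> B = disjoint_compl (disjoint_compl B)"

definition direct_sum_decomp :: "'a::real_vector set \<Rightarrow> 'a set \<Rightarrow> bool" where
  "direct_sum_decomp U V \<longleftrightarrow>
     subspace U \<and> subspace V \<and> U \<inter> V = {0} \<and> {u + v | u v. u \<in> U \<and> v \<in> V} = UNIV"

definition projection_band :: "'a::pre_riesz set \<Rightarrow> bool" where
  "projection_band B \<longleftrightarrow> band B \<and> direct_sum_decomp B (disjoint_compl B)"

text \<open>The projection onto \<open>B\<close> along \<open>C\<close> is the linear idempotent with range \<open>B\<close> and kernel \<open>C\<close>.\<close>

definition projection_onto_along ::
    "('a::real_vector \<Rightarrow> 'a) \<Rightarrow> 'a set \<Rightarrow> 'a set \<Rightarrow> bool" where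
  "projection_onto_along P B C \<longleftrightarrow> linear P \<and> P \<circ> P = P \<and> range P = B \<and> {x. P x = 0} = C"

definition band_projection :: "('a::pre_riesz \<Rightarrow> 'a) \<Rightarrow> bool" where
  "band_projection P \<longleftrightarrow>
     (\<exists>B. projection_band B \<and> projection_onto_along P B (disjoint_compl B))"

end

theory Submission
  imports Defs
begin

text \<open>
  Band projections are exactly the linear idempotents \<open>P\<close> with \<open>0 \<le> P \<le> id\<close>, and any two of them
  commute. For a set \<open>\<P>\<close> of them, the finite products \<open>Q\<close> of elements of \<open>\<P>\<close> therefore give a
  downwards directed family \<open>Q x\<close> for each \<open>x \<ge> 0\<close>, which has an infimum by Dedekind completeness.
  This infimum is additive and positively homogeneous on the cone and extends to a linear idempotent
  between \<open>0\<close> and \<open>id\<close> whose range is the intersection of the ranges. Finally \<open>z \<le> P x\<close> and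
  \<open>z \<le> Q x\<close> imply \<open>z \<le> P (Q x)\<close>, so that the finite products may be replaced by \<open>\<P>\<close> in the infimum.
\<close>

section \<open>Disjoint elements and common upper bounds\<close>

lemma disjoint_elems_iff:
  "disjoint_elems x y \<longleftrightarrow>
    (\<forall>u. x + y \<le> u \<and> - x - y \<le> u \<longleftrightarrow> x - y \<le> u \<and> y - x \<le> u)"
  by (simp add: disjoint_elems_def ubs_def isUb_def setle_def set_eq_iff)

lemma disjoint_elems_commute: "disjoint_elems x y \<longleftrightarrow> disjoint_elems y x"
  unfolding disjoint_elems_iff add.commute[of y x] minus_diff_commute[of y x] by blast

text \<open>The sum \<open>x + y\<close> is itself an upper bound of \<open>x + y\<close> and
  \<open>- x - y\<close>, hence by disjointness of \<open>x - y\<close> and \<open>y - x\<close>;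
  this says that \<open>2 y\<close> and \<open>2 x\<close> are positive. It later yields
  \<open>0 \<le> P x \<le> x\<close> for band projections.\<close>

lemma disjoint_elems_nonneg:
  fixes x y :: "'a::pre_riesz"
  assumes "disjoint_elems x y" "0 \<le> x + y"
  shows "0 \<le> x" "0 \<le> y"
proof -
  have "- x - y = - (x + y)"
    by simp
  also have "\<dots> \<le> 0"
    using assms(2) by (simp only: neg_le_0_iff_le)
  finally have "- x - y \<le> x + y"
    by (rule order_trans[OF _ assms(2)])
  then have "x - y \<le> x + y" "y - x \<le> x + y"
    using assms(1)[unfolded disjoint_elems_iff, rule_format, of "x + y"] order_refl by blast+
  then have "0 \<le> (x + y) - (x - y)" "0 \<le> (x + y) - (y - x)"
    by (simp_all only: diff_ge_0_iff_ge)
  moreover have "(x + y) - (x - y) = 2 *\<^sub>R y" "(x + y) - (y - x) = 2 *\<^sub>R x"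
    by (simp_all add: scaleR_2)
  ultimately have "0 \<le> 2 *\<^sub>R y" "0 \<le> 2 *\<^sub>R x"
    by (simp_all only:)
  then show "0 \<le> x" "0 \<le> y"
    by (simp_all add: zero_le_scaleR_iff)
qed

text \<open>
  A finite set without upper bounds would make the hypothesis of the pre-Riesz axiom vacuous, forcing
  the cone to be the whole space and hence the space to be trivial.
\<close>

lemma pre_riesz_ex_upper_bound:
  fixes a b :: "'a::pre_riesz"
  shows "\<exists>u. a \<le> u \<and> b \<le> u"
proof (rule ccontr)
  assume no_bound: "\<nexists>u. a \<le> u \<and> b \<le> u"
  have nonneg: "0 \<le> x" for x :: 'a
  proof (rule pre_riesz[of "{a, b}"])
    fix u
    assume "\<forall>c\<in>(+) x ` {a, b}. c \<le> u"
    then have "a \<le> u - x \<and> b \<le> u - x"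
      by (simp add: algebra_simps)
    then show "\<forall>c\<in>{a, b}. c \<le> u"
      using no_bound by blast
  qed auto
  have "a \<le> b"
    using nonneg[of "b - a"] by simp
  then show False
    using no_bound by blast
qed

section \<open>The generating cone and linear extension from it\<close>

lemma pre_riesz_nonneg_diff:
  fixes x :: "'a::pre_riesz"
  obtains a b where "0 \<le> a" "0 \<le> b" "x = a - b"
proof -
  obtain u where u: "x \<le> u" "0 \<le> u"
    using pre_riesz_ex_upper_bound by blast
  then show thesis
    using that[of u "u - x"] by simp
qed

text \<open>The value \<open>f a - f b\<close> depends only on \<open>a - b\<close>: if
  \<open>a - b = c - d\<close>, then \<open>a + d = c + b\<close>, and additivity applies. Positive
  scalars suffice, since negative ones are reached through \<open>g (- x) = - g x\<close>.\<close>

lemma linear_extension_nonneg: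
  fixes f :: "'a::pre_riesz \<Rightarrow> 'b::real_vector"
  assumes add: "\<And>x y. 0 \<le> x \<Longrightarrow> 0 \<le> y \<Longrightarrow> f (x + y) = f x + f y"
    and scale: "\<And>c x. 0 < c \<Longrightarrow> 0 \<le> x \<Longrightarrow> f (c *\<^sub>R x) = c *\<^sub>R f x"
  obtains g where "linear g" "\<And>x. 0 \<le> x \<Longrightarrow> g x = f x"
proof -
  have "\<exists>y. \<forall>a b. 0 \<le> a \<longrightarrow> 0 \<le> b \<longrightarrow> x = a - b \<longrightarrow> y = f a - f b" for x
  proof -
    obtain a b where ab: "0 \<le> a" "0 \<le> b" "x = a - b"
      by (rule pre_riesz_nonneg_diff)
    have "f a - f b = f c - f d" if "0 \<le> c" "0 \<le> d" "x = c - d" for c d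
    proof -
      have "a + d = c + b"
        using ab that by (simp add: algebra_simps)
      then have "f a + f d = f c + f b"
        using add ab that by metis
      then show ?thesis
        by (simp add: algebra_simps)
    qed
    then show ?thesis
      by blast
  qed
  then obtain g where g: "g x = f a - f b" if "0 \<le> a" "0 \<le> b" "x = a - b" for x a b
    by metis
  have f0: "f 0 = 0"
    using add[of 0 0] by simp
  have g_nonneg: "g x = f x" if "0 \<le> x" for x
    using g[of x 0 x] that f0 by simp
  have g_add: "g (x + y) = g x + g y" for x y
  proof -
    obtain a b where ab: "0 \<le> a" "0 \<le> b" "x = a - b"
      by (rule pre_riesz_nonneg_diff)
    obtain c d where cd: "0 \<le> c" "0 \<le> d" "y = c - d"
      by (rule pre_riesz_nonneg_diff)
    have "g (x + y) = f (a + c) - f (b + d)"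
      using ab cd by (intro g) auto
    then show ?thesis
      using g[OF ab] g[OF cd] add ab cd by simp
  qed
  have g_minus: "g (- x) = - g x" for x
    using g_add[of x "- x"] g_nonneg[of 0] f0 by (simp add: add_eq_0_iff)
  have g_pos: "g (c *\<^sub>R x) = c *\<^sub>R g x" if "0 < c" for c x
  proof -
    obtain a b where ab: "0 \<le> a" "0 \<le> b" "x = a - b"
      by (rule pre_riesz_nonneg_diff)
    have "g (c *\<^sub>R x) = f (c *\<^sub>R a) - f (c *\<^sub>R b)"
      using ab that by (intro g) (auto simp: scaleR_right_diff_distrib scaleR_nonneg_nonneg)
    then show ?thesis
      using g[OF ab] scale[OF that] ab by (simp add: scaleR_right_diff_distrib)
  qed
  have "g (c *\<^sub>R x) = c *\<^sub>R g x" for c x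
  proof (cases c "0::real" rule: linorder_cases)
    case less
    then show ?thesis
      using g_pos[of "- c" x] g_minus[of "c *\<^sub>R x"] by simp
  next
    case equal
    then show ?thesis
      using g_nonneg[of 0] f0 by simp
  next
    case greater
    then show ?thesis
      by (rule g_pos)
  qed
  then have "linear g"
    using g_add by (intro linearI)
  then show thesis
    using g_nonneg that by blast
qed

section \<open>Order projections and their identification with band projections\<close>

text \<open>On pre-Riesz spaces this turns out to coincide with \<open>band_projection\<close>. Free
  of bands and disjointness, it is easier to verify for products and infima.\<close>

definition order_projection :: "('a::ordered_real_vector \<Rightarrow> 'a) \<Rightarrow> bool" where
  "order_projection P \<longleftrightarrow> linear P \<and> (\<forall>x. P (P x) = P x) \<and> (\<forall>x\<ge>0. 0 \<le> P x \<and> P x \<le> x)"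

lemma order_projectionD:
  assumes "order_projection P"
  shows "linear P" "P (P x) = P x" "0 \<le> x \<Longrightarrow> 0 \<le> P x" "0 \<le> x \<Longrightarrow> P x \<le> x"
  using assms unfolding order_projection_def by auto

lemma order_projection_mono:
  assumes "order_projection P" "x \<le> y"
  shows "P x \<le> P y"
  using order_projectionD(1)[OF assms(1)] order_projectionD(3)[OF assms(1), of "y - x"] assms(2)
  by (simp add: linear_diff)

lemma order_projection_complement:
  assumes P: "order_projection P"
  shows "order_projection (\<lambda>x. x - P x)"
proof -
  have "linear (\<lambda>x. x - P x)"
    using order_projectionD(1)[OF P] by (intro linear_compose_sub linear_ident)
  then show ?thesis
    unfolding order_projection_def
    using order_projectionD[OF P] by (simp add: linear_diff)
qed

text \<open>An upper bound \<open>u\<close> of \<open>b + c\<close> and \<open>- b - c\<close>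
  splits into \<open>P u\<close>, which bounds \<open>b\<close> and \<open>- b\<close>, and
  \<open>u - P u\<close>, which bounds \<open>c\<close> and \<open>- c\<close>. The signs of
  \<open>b\<close> and \<open>c\<close> can therefore be chosen independently.\<close>

lemma order_projection_disjoint:
  fixes b c :: "'a::pre_riesz"
  assumes P: "order_projection P" and b: "P b = b" and c: "P c = 0"
  shows "disjoint_elems b c"
proof -
  have flip: "b - c' \<le> u" if "b + c' \<le> u" "- b - c' \<le> u" "P c' = 0" for c' u
  proof -
    have "b \<le> P u"
      using order_projection_mono[OF P that(1)] order_projectionD(1)[OF P] that b
      by (simp add: linear_add)
    moreover have "- c' \<le> u - P u"
      using order_projection_mono[OF order_projection_complement[OF P] that(2)]
        order_projectionD(1)[OF P] that b
      by (simp add: linear_diff linear_neg)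
    ultimately show ?thesis
      using add_mono by fastforce
  qed
  have flip': "c' - b \<le> u" if "b + c' \<le> u" "- b - c' \<le> u" "P c' = 0" for c' u
  proof -
    have "- b \<le> P u"
      using order_projection_mono[OF P that(2)] order_projectionD(1)[OF P] that b
      by (simp add: linear_diff linear_neg)
    moreover have "c' \<le> u - P u"
      using order_projection_mono[OF order_projection_complement[OF P] that(1)]
        order_projectionD(1)[OF P] that b
      by (simp add: linear_add)
    ultimately show ?thesis
      using add_mono by fastforce
  qed
  \<comment> \<open>Replacing \<open>c\<close> by \<open>- c\<close> interchanges the two sets of
    the disjointness condition, so the converse inclusion comes from the same two facts.\<close>
  have "P (- c) = 0"
    using c order_projectionD(1)[OF P] by (simp add: linear_neg)
  moreover have "b + - c = b - c" "- b - - c = c - b" "b - - c = b + c" "- c - b = - b - c"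
    by (simp_all add: algebra_simps)
  ultimately have "b + c \<le> u" "- b - c \<le> u" if "b - c \<le> u" "c - b \<le> u" for u
    using flip[of "- c" u] flip'[of "- c" u] that by (simp_all only:)
  then show ?thesis
    unfolding disjoint_elems_iff using flip[OF _ _ c] flip'[OF _ _ c] by blast
qed

text \<open>One inclusion is the disjointness just shown. For the other, disjointness of
  \<open>x\<close> from the single element \<open>P x\<close> already forces
  \<open>P x = 0\<close>.\<close>

lemma disjoint_compl_range_order_projection:
  fixes P :: "'a::pre_riesz \<Rightarrow> 'a"
  assumes P: "order_projection P"
  shows "disjoint_compl (range P) = {x. P x = 0}"
proof
  show "{x. P x = 0} \<subseteq> disjoint_compl (range P)"
    unfolding disjoint_compl_def
    using order_projection_disjoint[OF P] order_projectionD(2)[OF P] disjoint_elems_commute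
    by blast
  show "disjoint_compl (range P) \<subseteq> {x. P x = 0}"
  proof
    fix x
    assume "x \<in> disjoint_compl (range P)"
    then have disj: "disjoint_elems x (P x)"
      unfolding disjoint_compl_def by auto
    note lin = order_projectionD(1)[OF P]
    note idem = order_projectionD(2)[OF P]
    let ?Q = "\<lambda>x. x - P x"
    obtain u where u: "x - P x \<le> u" "- (x - P x) \<le> u"
      using pre_riesz_ex_upper_bound by blast
    txt \<open>The bound \<open>u - P u\<close> lies in the kernel of \<open>P\<close>, hence forces \<open>\<plusminus>2 P x \<le> 0\<close> below.\<close>
    have "x - P x \<le> ?Q u" "P x - x \<le> ?Q u"
      using order_projection_mono[OF order_projection_complement[OF P] u(1)]
        order_projection_mono[OF order_projection_complement[OF P] u(2)]
      by (simp_all add: lin idem linear_diff linear_neg)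
    then have "x + P x \<le> ?Q u" "- x - P x \<le> ?Q u"
      using disj unfolding disjoint_elems_iff by auto
    then have "P (x + P x) \<le> P (?Q u)" "P (- x - P x) \<le> P (?Q u)"
      using order_projection_mono[OF P] by blast+
    moreover have "P (x + P x) = 2 *\<^sub>R P x" "P (- x - P x) = - (2 *\<^sub>R P x)" "P (?Q u) = 0"
      by (simp_all add: lin idem linear_diff linear_neg linear_add scaleR_2)
    ultimately have "P x \<le> 0" "0 \<le> P x"
      by (simp_all add: scaleR_le_0_iff zero_le_scaleR_iff)
    then show "x \<in> {x. P x = 0}"
      by (simp add: antisym)
  qed
qed

text \<open>The formula for the disjoint complement applies to \<open>P\<close> and to
  \<open>x - P x\<close>, whose range and kernel are those of \<open>P\<close> interchanged. Two
  complements thus lead back to \<open>range P\<close>.\<close>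

lemma projection_band_range_order_projection:
  fixes P :: "'a::pre_riesz \<Rightarrow> 'a"
  assumes P: "order_projection P"
  shows "projection_band (range P)"
proof -
  note lin = order_projectionD(1)[OF P]
  note idem = order_projectionD(2)[OF P]
  let ?Q = "\<lambda>x. x - P x"
  have range_Q: "range ?Q = {x. P x = 0}"
  proof
    have "x \<in> range ?Q" if "P x = 0" for x
      using that by (intro range_eqI[of _ _ x]) simp
    then show "{x. P x = 0} \<subseteq> range ?Q"
      by blast
  qed (auto simp: lin idem linear_diff)
  have "disjoint_compl {x. P x = 0} = {x. ?Q x = 0}"
    using disjoint_compl_range_order_projection[OF order_projection_complement[OF P]] range_Q
    by simp
  also have "\<dots> = range P"
    using idem by (auto intro: rangeI)
  finally have "band (range P)"
    unfolding band_def disjoint_compl_range_order_projection[OF P] by simp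
  moreover have "direct_sum_decomp (range P) {x. P x = 0}"
    unfolding direct_sum_decomp_def
  proof (intro conjI)
    show "subspace (range P)" "subspace {x. P x = 0}"
      using linear_subspace_image[OF lin subspace_UNIV] linear_subspace_kernel[OF lin] by simp_all
    show "range P \<inter> {x. P x = 0} = {0}"
    proof
      show "range P \<inter> {x. P x = 0} \<subseteq> {0}"
        using idem by auto
      have "0 \<in> range P"
        using linear_0[OF lin] by (metis rangeI)
      then show "{0} \<subseteq> range P \<inter> {x. P x = 0}"
        using linear_0[OF lin] by simp
    qed
    have "x \<in> {u + v | u v. u \<in> range P \<and> v \<in> {x. P x = 0}}" for x
    proof -
      have "x = P x + ?Q x" "P (?Q x) = 0"
        by (auto simp: lin idem linear_diff)
      then show ?thesis
        by blast
    qed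
    then show "{u + v | u v. u \<in> range P \<and> v \<in> {x. P x = 0}} = UNIV"
      by blast
  qed
  ultimately show ?thesis
    unfolding projection_band_def disjoint_compl_range_order_projection[OF P] by simp
qed

text \<open>For a band projection, \<open>x\<close> is the sum of the disjoint elements
  \<open>x - P x\<close> and \<open>P x\<close>, so both are positive whenever \<open>x\<close>
  is.\<close>

lemma band_projection_iff_order_projection:
  fixes P :: "'a::pre_riesz \<Rightarrow> 'a"
  shows "band_projection P \<longleftrightarrow> order_projection P"
proof
  assume P: "order_projection P"
  then have "projection_onto_along P (range P) (disjoint_compl (range P))"
    unfolding projection_onto_along_def disjoint_compl_range_order_projection[OF P]
    using order_projectionD[OF P] by auto
  then show "band_projection P"
    unfolding band_projection_def using projection_band_range_order_projection[OF P] by blast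
next
  assume "band_projection P"
  then obtain B where "projection_onto_along P B (disjoint_compl B)"
    unfolding band_projection_def by blast
  then have lin: "linear P" and idem: "P (P x) = P x" and B: "range P = B"
    and ker: "{x. P x = 0} = disjoint_compl B" for x
    unfolding projection_onto_along_def by (auto simp: fun_eq_iff)
  have disj: "disjoint_elems (x - P x) (P x)" for x
  proof -
    have "x - P x \<in> disjoint_compl B"
      unfolding ker[symmetric] by (simp add: lin idem linear_diff)
    then show ?thesis
      unfolding disjoint_compl_def using B by blast
  qed
  show "order_projection P"
    unfolding order_projection_def
  proof (intro conjI allI impI)
    fix x :: 'a
    assume "0 \<le> x"
    then show "0 \<le> P x" "P x \<le> x"
      using disjoint_elems_nonneg[OF disj[of x]] by simp_all
  qed (simp_all add: lin idem)
qed

text \<open>The kernel is the disjoint complement of the range, so equal ranges force equal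
  kernels.\<close>

lemma band_projection_unique:
  fixes P Q :: "'a::pre_riesz \<Rightarrow> 'a"
  assumes "band_projection P" "band_projection Q" "range P = range Q"
  shows "P = Q"
proof
  fix x
  have P: "order_projection P" and Q: "order_projection Q"
    using assms by (simp_all add: band_projection_iff_order_projection)
  have "{x. P x = 0} = {x. Q x = 0}"
    using disjoint_compl_range_order_projection[OF P] disjoint_compl_range_order_projection[OF Q]
      assms(3) by simp
  moreover have "P (x - P x) = 0"
    using order_projectionD(1,2)[OF P] by (simp add: linear_diff)
  ultimately have "Q (x - P x) = 0"
    by blast
  then have "Q x = Q (P x)"
    using order_projectionD(1)[OF Q] by (simp add: linear_diff)
  also have "\<dots> = P x"
  proof -
    obtain y where "P x = Q y"
      using assms(3) by blast
    then show ?thesis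
      using order_projectionD(2)[OF Q] by simp
  qed
  finally show "P x = Q x" ..
qed

lemma projection_band_ex_band_projection:
  fixes B :: "'a::pre_riesz set"
  assumes B: "projection_band B"
  obtains P where "band_projection P" "range P = B"
proof -
  let ?C = "disjoint_compl B"
  have sub: "subspace B" "subspace ?C" and int: "B \<inter> ?C = {0}"
    and sum: "{u + v | u v. u \<in> B \<and> v \<in> ?C} = UNIV"
    using B unfolding projection_band_def direct_sum_decomp_def by auto
  have "\<exists>u. u \<in> B \<and> x - u \<in> ?C" for x
  proof -
    have "x \<in> {u + v | u v. u \<in> B \<and> v \<in> ?C}"
      using sum by simp
    then show ?thesis
      by force
  qed
  then obtain P where P: "P x \<in> B" "x - P x \<in> ?C" for x
    by metis
  \<comment> \<open>The component in \<open>B\<close> is unique because \<open>B\<close> meets its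
    complement only in \<open>0\<close>; linearity and the kernel of the chosen \<open>P\<close> all
    follow from this.\<close>
  have eq: "P x = u" if "u \<in> B" "x - u \<in> ?C" for x u
  proof -
    have "P x - u \<in> B"
      using P that sub by (simp add: subspace_diff)
    moreover have "(x - u) - (x - P x) \<in> ?C"
      using P(2)[of x] that(2) sub(2) by (blast intro: subspace_diff)
    then have "P x - u \<in> ?C"
      by simp
    ultimately have "P x - u \<in> {0}"
      using int by blast
    then show ?thesis
      by simp
  qed
  have "linear P"
  proof (rule linearI)
    fix x y and c :: real
    have "(x - P x) + (y - P y) \<in> ?C" "c *\<^sub>R (x - P x) \<in> ?C"
      using P sub by (auto intro: subspace_add subspace_scale)
    then show "P (x + y) = P x + P y" "P (c *\<^sub>R x) = c *\<^sub>R P x"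
      using P sub
      by (auto intro!: eq subspace_add subspace_scale simp: algebra_simps)
  qed
  moreover have fixed: "P u = u" if "u \<in> B" for u
    using that sub by (intro eq) (auto simp: subspace_0)
  moreover have "range P = B"
    using P(1) fixed by (metis image_subsetI rangeI subsetI subset_antisym)
  moreover have "{x. P x = 0} = ?C"
  proof
    show "{x. P x = 0} \<subseteq> ?C"
      using P(2) by (metis (mono_tags) diff_zero mem_Collect_eq subsetI)
    show "?C \<subseteq> {x. P x = 0}"
      using eq[of 0] subspace_0[OF sub(1)] by auto
  qed
  ultimately have "projection_onto_along P B ?C"
    unfolding projection_onto_along_def using P(1) by (simp add: fun_eq_iff)
  then show thesis
    using that B \<open>range P = B\<close> unfolding band_projection_def by blast
qed

section \<open>Commutation and finite products\<close>

text \<open>\<open>Q\<close> maps the range of every order projection into itself. Applied to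
  \<open>P\<close> and to its complement, this makes both range and kernel of \<open>P\<close>
  invariant under \<open>Q\<close>.\<close>

lemma order_projection_commute:
  fixes P Q :: "'a::pre_riesz \<Rightarrow> 'a"
  assumes P: "order_projection P" and Q: "order_projection Q"
  shows "P (Q x) = Q (P x)"
proof -
  note linQ = order_projectionD(1)[OF Q]
  have invariant: "R (Q (R y)) = Q (R y)" if R: "order_projection R" for R :: "'a \<Rightarrow> 'a" and y
  proof -
    note linR = order_projectionD(1)[OF R]
    let ?S = "\<lambda>x. x - R x"
    \<comment> \<open>The element lies between \<open>0\<close> and \<open>R a\<close>, and the
      monotone map \<open>?S\<close> sends both ends to \<open>0\<close>.\<close>
    have zero: "?S (Q (R a)) = 0" if "0 \<le> a" for a
    proof (rule antisym)
      have Ra: "0 \<le> R a"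
        using order_projectionD(3)[OF R that] .
      have "?S (Q (R a)) \<le> ?S (R a)"
        using order_projection_mono[OF order_projection_complement[OF R]]
          order_projectionD(4)[OF Q Ra] by blast
      then show "?S (Q (R a)) \<le> 0"
        using order_projectionD(2)[OF R] by simp
      show "0 \<le> ?S (Q (R a))"
        using order_projectionD(3)[OF order_projection_complement[OF R]]
          order_projectionD(3)[OF Q Ra] by blast
    qed
    obtain a b where "0 \<le> a" "0 \<le> b" "y = a - b"
      by (rule pre_riesz_nonneg_diff)
    then show ?thesis
      using zero[of a] zero[of b] by (simp add: linR linQ linear_diff)
  qed
  have "P (Q (P x)) = Q (P x)"
    using invariant[OF P] .
  moreover have "P (Q (x - P x)) = 0"
    using invariant[OF order_projection_complement[OF P], of x] by simp
  ultimately show ?thesis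
    using order_projectionD(1)[OF P] linQ by (simp add: linear_diff)
qed

lemma order_projection_comp:
  fixes P Q :: "'a::pre_riesz \<Rightarrow> 'a"
  assumes P: "order_projection P" and Q: "order_projection Q"
  shows "order_projection (P \<circ> Q)"
  unfolding order_projection_def
proof (intro conjI allI impI)
  show "linear (P \<circ> Q)"
    using order_projectionD(1) P Q by (blast intro: linear_compose)
  show "(P \<circ> Q) ((P \<circ> Q) x) = (P \<circ> Q) x" for x
    using order_projection_commute[OF P Q] order_projectionD(2)[OF P] order_projectionD(2)[OF Q]
    by simp
  show "0 \<le> (P \<circ> Q) x" "(P \<circ> Q) x \<le> x" if "0 \<le> x" for x
    using order_projectionD(3,4)[OF Q that] order_projectionD(3,4)[OF P, of "Q x"] by auto
qed

text \<open>Applying the complement of \<open>P\<close> to \<open>z \<le> P x\<close> gives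
  \<open>z \<le> P z\<close>; then \<open>P\<close> is applied to \<open>z \<le> y\<close>. The sign
  of \<open>z\<close> is arbitrary, as it must be for lower bounds.\<close>

lemma le_order_projection_comp:
  assumes P: "order_projection P" and "z \<le> P x" "z \<le> y"
  shows "z \<le> P y"
proof -
  have "z - P z \<le> P x - P (P x)"
    using order_projection_mono[OF order_projection_complement[OF P] assms(2)] .
  then have "z - P z \<le> 0"
    using order_projectionD(2)[OF P] by simp
  then have "z \<le> P z"
    by simp
  also have "\<dots> \<le> P y"
    using order_projection_mono[OF P assms(3)] .
  finally show ?thesis .
qed

text \<open>Starting from \<open>id\<close> keeps the family non-empty. For empty
  \<open>\<P>\<close> it yields the identity, in accordance with the empty intersection being the
  whole space.\<close>

inductive_set finite_products :: "('a \<Rightarrow> 'a) set \<Rightarrow> ('a \<Rightarrow> 'a) set" for \<P> where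
  id: "id \<in> finite_products \<P>"
| comp: "P \<in> \<P> \<Longrightarrow> Q \<in> finite_products \<P> \<Longrightarrow> P \<circ> Q \<in> finite_products \<P>"

lemma finite_products_comp:
  assumes "P \<in> finite_products \<P>" "Q \<in> finite_products \<P>"
  shows "P \<circ> Q \<in> finite_products \<P>"
  using assms(1)
proof induction
  case id
  then show ?case
    using assms(2) by simp
next
  case (comp R S)
  then show ?case
    using finite_products.comp[OF comp.hyps(1) comp.IH] by (simp only: comp_assoc)
qed

lemma finite_products_base: "P \<in> \<P> \<Longrightarrow> P \<in> finite_products \<P>"
  using finite_products.comp[OF _ finite_products.id, of P \<P>] by (simp only: comp_id)

lemma order_projection_finite_products:
  fixes \<P> :: "('a::pre_riesz \<Rightarrow> 'a) set"
  assumes "Q \<in> finite_products \<P>" "\<And>P. P \<in> \<P> \<Longrightarrow> order_projection P"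
  shows "order_projection Q"
  using assms(1)
proof induction
  case id
  then show ?case
    unfolding order_projection_def by (simp add: linear_id)
next
  case (comp P Q)
  then show ?case
    using order_projection_comp assms(2) by blast
qed

section \<open>Directed infima and the projection onto the intersection\<close>

text \<open>Negation turns the directed supremum into an infimum. The equivalence for all
  \<open>z\<close> determines \<open>i\<close> by antisymmetry and allows infima to be compared
  through their lower bounds.\<close>

lemma directed_inf_exists:
  fixes A :: "'a::dedekind_complete_pre_riesz set"
  assumes "A \<noteq> {}" and directed: "\<And>x y. x \<in> A \<Longrightarrow> y \<in> A \<Longrightarrow> \<exists>z\<in>A. z \<le> x \<and> z \<le> y"
    and bound: "\<And>x. x \<in> A \<Longrightarrow> m \<le> x"
  obtains i where "\<And>z. z \<le> i \<longleftrightarrow> (\<forall>x\<in>A. z \<le> x)"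
proof -
  have "upwards_directed (uminus ` A)"
    unfolding upwards_directed_def using directed by auto
  moreover have "bdd_above (uminus ` A)"
    using bound by (intro bdd_aboveI[of _ "- m"]) auto
  ultimately obtain s where s: "\<forall>a\<in>uminus ` A. a \<le> s"
    "\<forall>u. (\<forall>a\<in>uminus ` A. a \<le> u) \<longrightarrow> s \<le> u"
    using directed_sup_exists[of "uminus ` A"] \<open>A \<noteq> {}\<close> by blast
  have "z \<le> - s \<longleftrightarrow> (\<forall>x\<in>A. z \<le> x)" for z
  proof
    show "\<forall>x\<in>A. z \<le> x" if "z \<le> - s"
      using s(1) that by (auto simp: minus_le_iff intro: order_trans)
    show "z \<le> - s" if "\<forall>x\<in>A. z \<le> x"
    proof -
      have "s \<le> - z"
        using s(2) that by auto
      then show ?thesis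
        by (simp add: le_minus_iff)
    qed
  qed
  then show thesis
    by (rule that)
qed

text \<open>The infimum runs over finite products because the values \<open>P x\<close> for
  \<open>P \<in> \<P>\<close> need not be directed.\<close>

lemma ex_order_projection_Inf:
  fixes \<P> :: "('a::dedekind_complete_pre_riesz \<Rightarrow> 'a) set"
  assumes \<P>: "\<And>P. P \<in> \<P> \<Longrightarrow> order_projection P"
  obtains P\<^sub>0 where "order_projection P\<^sub>0" "range P\<^sub>0 = (\<Inter>P\<in>\<P>. range P)"
    "\<forall>x\<ge>0. \<forall>z. z \<le> P\<^sub>0 x \<longleftrightarrow> (\<forall>Q\<in>finite_products \<P>. z \<le> Q x)"
proof -
  let ?\<Q> = "finite_products \<P>"
  have \<Q>: "order_projection Q" if "Q \<in> ?\<Q>" for Q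
    using order_projection_finite_products[OF that] \<P> by blast
  have "\<exists>i. \<forall>z. z \<le> i \<longleftrightarrow> (\<forall>Q\<in>?\<Q>. z \<le> Q x)" if x: "0 \<le> x" for x
  proof (rule directed_inf_exists[of "(\<lambda>Q. Q x) ` ?\<Q>" 0])
    show "(\<lambda>Q. Q x) ` ?\<Q> \<noteq> {}"
      using finite_products.id by blast
    show "0 \<le> y" if "y \<in> (\<lambda>Q. Q x) ` ?\<Q>" for y
      using that order_projectionD(3)[OF \<Q> x] by blast
    fix y y'
    assume "y \<in> (\<lambda>Q. Q x) ` ?\<Q>" "y' \<in> (\<lambda>Q. Q x) ` ?\<Q>"
    then obtain Q Q' where Q: "Q \<in> ?\<Q>" "y = Q x" and Q': "Q' \<in> ?\<Q>" "y' = Q' x"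
      by blast
    have "(Q \<circ> Q') x \<le> Q x"
      using order_projection_mono[OF \<Q>[OF Q(1)] order_projectionD(4)[OF \<Q>[OF Q'(1)] x]] by simp
    moreover have "(Q \<circ> Q') x \<le> Q' x"
      using order_projectionD(4)[OF \<Q>[OF Q(1)] order_projectionD(3)[OF \<Q>[OF Q'(1)] x]] by simp
    ultimately show "\<exists>z\<in>(\<lambda>Q. Q x) ` ?\<Q>. z \<le> y \<and> z \<le> y'"
      using finite_products_comp[OF Q(1) Q'(1)] Q(2) Q'(2) by blast
  qed auto
  then obtain f where f: "z \<le> f x \<longleftrightarrow> (\<forall>Q\<in>?\<Q>. z \<le> Q x)" if "0 \<le> x" for x z
    by metis
  have f_le: "f x \<le> Q x" if "0 \<le> x" "Q \<in> ?\<Q>" for Q x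
    using f that by blast
  have f_add: "f (x + y) = f x + f y" if x: "0 \<le> x" and y: "0 \<le> y" for x y
  proof (rule antisym)
    \<comment> \<open>Independent \<open>Q\<close> and \<open>Q'\<close> allow the infimum to be
      taken first over \<open>Q\<close> and then over \<open>Q'\<close>; the product
      \<open>Q \<circ> Q'\<close> serves both summands.\<close>
    have "f (x + y) \<le> Q x + Q' y" if Q: "Q \<in> ?\<Q>" and Q': "Q' \<in> ?\<Q>" for Q Q'
    proof -
      have "f (x + y) \<le> Q (Q' (x + y))"
        using f_le[OF _ finite_products_comp[OF Q Q']] x y by simp
      also have "\<dots> = Q (Q' x) + Q (Q' y)"
        using order_projectionD(1) \<Q> Q Q' by (metis linear_add)
      also have "\<dots> \<le> Q x + Q' y"
        using order_projection_mono[OF \<Q>[OF Q] order_projectionD(4)[OF \<Q>[OF Q'] x]]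
          order_projectionD(4)[OF \<Q>[OF Q] order_projectionD(3)[OF \<Q>[OF Q'] y]]
        by (rule add_mono)
      finally show ?thesis .
    qed
    then have "f (x + y) - Q' y \<le> f x" if "Q' \<in> ?\<Q>" for Q'
      using f[OF x] that by (simp add: diff_le_eq)
    then have "f (x + y) - f x \<le> f y"
      using f[OF y] by (simp add: algebra_simps)
    then show "f (x + y) \<le> f x + f y"
      by (simp add: algebra_simps)
    have "f x + f y \<le> Q (x + y)" if "Q \<in> ?\<Q>" for Q
      using add_mono[OF f_le[OF x that] f_le[OF y that]] order_projectionD(1)[OF \<Q>[OF that]]
      by (simp add: linear_add)
    then show "f x + f y \<le> f (x + y)"
      using f[of "x + y"] x y by simp
  qed
  have f_scale: "f (c *\<^sub>R x) = c *\<^sub>R f x" if c: "0 < c" and x: "0 \<le> x" for c x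
  proof -
    have "z \<le> f (c *\<^sub>R x) \<longleftrightarrow> z \<le> c *\<^sub>R f x" for z
    proof -
      have "z \<le> f (c *\<^sub>R x) \<longleftrightarrow> (\<forall>Q\<in>?\<Q>. z \<le> Q (c *\<^sub>R x))"
        using c x by (intro f) (simp add: scaleR_nonneg_nonneg)
      also have "\<dots> \<longleftrightarrow> (\<forall>Q\<in>?\<Q>. z /\<^sub>R c \<le> Q x)"
        using order_projectionD(1)[OF \<Q>] by (simp add: linear_scale pos_divideR_le_eq[OF c])
      also have "\<dots> \<longleftrightarrow> z \<le> c *\<^sub>R f x"
        using f[OF x] pos_divideR_le_eq[OF c] by metis
      finally show ?thesis .
    qed
    then show ?thesis
      by (meson antisym order_refl)
  qed
  obtain P\<^sub>0 where lin: "linear P\<^sub>0" and P\<^sub>0: "\<And>x. 0 \<le> x \<Longrightarrow> P\<^sub>0 x = f x"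
    using linear_extension_nonneg[of f, OF f_add f_scale] by blast
  have P\<^sub>0_bounds: "0 \<le> P\<^sub>0 x" "P\<^sub>0 x \<le> x" if "0 \<le> x" for x
    using P\<^sub>0[OF that] f[OF that, of 0] f_le[OF that finite_products.id]
      order_projectionD(3)[OF \<Q> that] by auto
  have P_P\<^sub>0: "P (P\<^sub>0 x) = P\<^sub>0 x" if P: "P \<in> \<P>" for P x
  proof -
    let ?S = "\<lambda>x. x - P x"
    \<comment> \<open>Since \<open>0 \<le> P\<^sub>0 a \<le> P a\<close> and \<open>?S\<close>
      annihilates \<open>P a\<close>, the squeezing argument of commutation applies again.\<close>
    have zero: "?S (P\<^sub>0 a) = 0" if a: "0 \<le> a" for a
    proof (rule antisym)
      have "?S (P\<^sub>0 a) \<le> ?S (P a)"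
        using order_projection_mono[OF order_projection_complement[OF \<P>[OF P]]]
          f_le[OF a finite_products_base[OF P]] P\<^sub>0[OF a] by metis
      then show "?S (P\<^sub>0 a) \<le> 0"
        using order_projectionD(2)[OF \<P>[OF P]] by simp
      show "0 \<le> ?S (P\<^sub>0 a)"
        using order_projectionD(3)[OF order_projection_complement[OF \<P>[OF P]]] P\<^sub>0_bounds[OF a]
        by blast
    qed
    obtain a b where "0 \<le> a" "0 \<le> b" "x = a - b"
      by (rule pre_riesz_nonneg_diff)
    then show ?thesis
      using zero[of a] zero[of b] lin order_projectionD(1)[OF \<P>[OF P]] by (simp add: linear_diff)
  qed
  have P\<^sub>0_fixed: "P\<^sub>0 x = x" if x: "x \<in> (\<Inter>P\<in>\<P>. range P)" for x
  proof -
    obtain a b where ab: "0 \<le> a" "0 \<le> b" "x = a - b"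
      by (rule pre_riesz_nonneg_diff)
    have "Q x = x" if "Q \<in> ?\<Q>" for Q
      using that
    proof induction
      case (comp P Q)
      then show ?case
        using x order_projectionD(2)[OF \<P>] by force
    qed simp
    \<comment> \<open>As every \<open>Q\<close> fixes \<open>x = a - b\<close>, the values at
      \<open>a\<close> are those at \<open>b\<close> translated by \<open>x\<close>, and infima
      commute with translation.\<close>
    then have Q_a: "Q a = x + Q b" if "Q \<in> ?\<Q>" for Q
      using that ab(3) linear_diff[OF order_projectionD(1)[OF \<Q>[OF that]], of a b]
      by (metis diff_add_cancel)
    have "z \<le> f a \<longleftrightarrow> z \<le> x + f b" for z
    proof -
      have "z \<le> f a \<longleftrightarrow> (\<forall>Q\<in>?\<Q>. z - x \<le> Q b)"
        using f[OF ab(1)] Q_a by (simp add: algebra_simps)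
      also have "\<dots> \<longleftrightarrow> z \<le> x + f b"
        using f[OF ab(2), of "z - x"] by (simp add: algebra_simps)
      finally show ?thesis .
    qed
    then have "f a = x + f b"
      by (meson antisym order_refl)
    then show ?thesis
      using ab(3) P\<^sub>0[OF ab(1)] P\<^sub>0[OF ab(2)] lin by (simp add: linear_diff)
  qed
  have P\<^sub>0_mem: "P\<^sub>0 x \<in> (\<Inter>P\<in>\<P>. range P)" for x
    using P_P\<^sub>0 by (metis INT_I rangeI)
  show thesis
  proof (rule that)
    show "order_projection P\<^sub>0"
      unfolding order_projection_def
      \<comment> \<open>Idempotence: each value of \<open>P\<^sub>0\<close> lies in the
        intersection, where \<open>P\<^sub>0\<close> is the identity.\<close>
      by (simp add: lin P\<^sub>0_bounds P\<^sub>0_fixed[OF P\<^sub>0_mem])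
    show "range P\<^sub>0 = (\<Inter>P\<in>\<P>. range P)"
    proof
      show "range P\<^sub>0 \<subseteq> (\<Inter>P\<in>\<P>. range P)"
        using P\<^sub>0_mem by (rule image_subsetI)
      show "(\<Inter>P\<in>\<P>. range P) \<subseteq> range P\<^sub>0"
        using P\<^sub>0_fixed by (metis rangeI subsetI)
    qed
    show "\<forall>x\<ge>0. \<forall>z. z \<le> P\<^sub>0 x \<longleftrightarrow> (\<forall>Q\<in>?\<Q>. z \<le> Q x)"
      using f P\<^sub>0 by simp
  qed
qed

section \<open>Infima over the original family and the final result\<close>

lemma isGlb_UNIV_iff:
  fixes i :: "'a::order"
  shows "isGlb UNIV S i \<longleftrightarrow> (\<forall>z. z \<le> i \<longleftrightarrow> (\<forall>s\<in>S. z \<le> s))"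
  (is "?L \<longleftrightarrow> ?R")
proof -
  have "?L \<longleftrightarrow> (\<forall>s\<in>S. i \<le> s) \<and> (\<forall>z. (\<forall>s\<in>S. z \<le> s) \<longrightarrow> z \<le> i)"
    by (simp add: isGlb_def greatestP_def isLb_def setge_def setle_def)
  also have "\<dots> \<longleftrightarrow> ?R"
    using order_refl order_trans by metis
  finally show ?thesis .
qed

text \<open>Induction over products shows that the values of \<open>\<P>\<close> at \<open>x\<close>
  and those of its finite products have the same lower bounds.\<close>

lemma isGlb_order_projections:
  fixes \<P> :: "('a::pre_riesz \<Rightarrow> 'a) set"
  assumes \<P>: "\<And>P. P \<in> \<P> \<Longrightarrow> order_projection P" and "\<P> \<noteq> {}" and "0 \<le> x"
    and i: "\<And>z. z \<le> i \<longleftrightarrow> (\<forall>Q\<in>finite_products \<P>. z \<le> Q x)"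
  shows "isGlb UNIV {P x | P. P \<in> \<P>} i"
proof -
  have "z \<le> Q x" if z: "\<And>P. P \<in> \<P> \<Longrightarrow> z \<le> P x" and Q: "Q \<in> finite_products \<P>" for z Q
    using Q
  proof induction
    case id
    \<comment> \<open>Non-emptiness enters here: some \<open>P\<close> gives
      \<open>z \<le> P x \<le> x\<close>.\<close>
    obtain P where "P \<in> \<P>"
      using \<open>\<P> \<noteq> {}\<close> by blast
    then show ?case
      using z order_projectionD(4)[OF \<P> \<open>0 \<le> x\<close>] by fastforce
  next
    case (comp P Q)
    then show ?case
      using le_order_projection_comp[OF \<P>[OF comp.hyps(1)] z[OF comp.hyps(1)]] by simp
  qed
  then have "(\<forall>Q\<in>finite_products \<P>. z \<le> Q x) \<longleftrightarrow> (\<forall>P\<in>\<P>. z \<le> P x)" for z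
    using finite_products_base by blast
  then show ?thesis
    unfolding isGlb_UNIV_iff by (auto simp: i)
qed

theorem corollary3p13:
  shows "(\<forall>\<B> :: 'a::dedekind_complete_pre_riesz set set.
            (\<forall>B\<in>\<B>. projection_band B) \<longrightarrow> projection_band (\<Inter>\<B>)) \<and>
         (\<forall>\<P> :: ('a \<Rightarrow> 'a) set.
            (\<forall>P\<in>\<P>. band_projection P) \<longrightarrow>
              (\<exists>!P\<^sub>0. band_projection P\<^sub>0 \<and> range P\<^sub>0 = (\<Inter>P\<in>\<P>. range P)) \<and>
              (\<forall>P\<^sub>0. band_projection P\<^sub>0 \<and> range P\<^sub>0 = (\<Inter>P\<in>\<P>. range P) \<longrightarrow>
                 \<P> \<noteq> {} \<longrightarrow> (\<forall>x\<ge>0. isGlb UNIV {P x | P. P \<in> \<P>} (P\<^sub>0 x))))"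
proof (intro conjI allI impI)
  fix \<B> :: "'a set set"
  assume \<B>: "\<forall>B\<in>\<B>. projection_band B"
  \<comment> \<open>Each band in \<open>\<B>\<close> is the range of some band projection, so the
    claim on bands reduces to the one on projections.\<close>
  define \<P> where "\<P> = {P. band_projection P \<and> range P \<in> \<B>}"
  obtain P\<^sub>0 where P\<^sub>0: "order_projection P\<^sub>0" "range P\<^sub>0 = (\<Inter>P\<in>\<P>. range P)"
  proof (rule ex_order_projection_Inf[of \<P>])
    show "order_projection P" if "P \<in> \<P>" for P
      using that by (simp add: \<P>_def band_projection_iff_order_projection)
  qed
  have "range ` \<P> = \<B>"
  proof
    show "range ` \<P> \<subseteq> \<B>"
      by (auto simp: \<P>_def)
    show "\<B> \<subseteq> range ` \<P>"
    proof
      fix B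
      assume "B \<in> \<B>"
      then obtain P where "band_projection P" "range P = B"
        using projection_band_ex_band_projection \<B> by metis
      then show "B \<in> range ` \<P>"
        using \<open>B \<in> \<B>\<close> by (intro image_eqI[of _ _ P]) (simp_all add: \<P>_def)
    qed
  qed
  then show "projection_band (\<Inter>\<B>)"
    using projection_band_range_order_projection[OF P\<^sub>0(1)] P\<^sub>0(2) by simp
next
  fix \<P> :: "('a \<Rightarrow> 'a) set"
  assume "\<forall>P\<in>\<P>. band_projection P"
  then have \<P>: "order_projection P" if "P \<in> \<P>" for P
    using that by (simp add: band_projection_iff_order_projection)
  obtain P\<^sub>0 where P\<^sub>0: "order_projection P\<^sub>0" "range P\<^sub>0 = (\<Inter>P\<in>\<P>. range P)"
    "\<forall>x\<ge>0. \<forall>z. z \<le> P\<^sub>0 x \<longleftrightarrow> (\<forall>Q\<in>finite_products \<P>. z \<le> Q x)"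
    by (rule ex_order_projection_Inf[OF \<P>])
  have band: "band_projection P\<^sub>0"
    using P\<^sub>0(1) by (simp add: band_projection_iff_order_projection)
  have unique: "P = P\<^sub>0" if "band_projection P \<and> range P = (\<Inter>P\<in>\<P>. range P)" for P
    using that band_projection_unique[OF _ band] P\<^sub>0(2) by simp
  show "\<exists>!P\<^sub>0. band_projection P\<^sub>0 \<and> range P\<^sub>0 = (\<Inter>P\<in>\<P>. range P)"
    using conjI[OF band P\<^sub>0(2)] unique by (rule ex1I)
  show "isGlb UNIV {P x | P. P \<in> \<P>} (P\<^sub>1 x)"
    if "band_projection P\<^sub>1 \<and> range P\<^sub>1 = (\<Inter>P\<in>\<P>. range P)" "\<P> \<noteq> {}" "0 \<le> x" for P\<^sub>1 x
    \<comment> \<open>By uniqueness \<open>P\<^sub>1\<close> is the constructed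
      \<open>P\<^sub>0\<close>, whose infimum property is at hand.\<close>
    unfolding unique[OF that(1)]
    using \<P> that(2,3) P\<^sub>0(3)[rule_format, OF that(3)] by (rule isGlb_order_projections)
qed

end
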